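(* Let $f:\mathbb{R}^n\to\mathbb{R}$ be twice continuously differentiable with $L$-Lipschitz gradient, let $\alpha\in(0,\frac1L)$, and let $x^*$ be a strict saddle point of $f$. Then the Jacobian $D[g_{\alpha(-f)}]^{-1}(x^* )$ of the inverse of $g_{\alpha(-f)}=g^1_{\alpha(-f)}\circ\cdots\circ g^p_{\alpha(-f)}$ at $x^*$ has at least one eigenvalue whose modulus is strictly greater than one.
   Context: $\|\nabla f(x)-\nabla f(y)\|\le L\|x-y\|$ for all $x,y$, $L>0$. The variable is partitioned as $x=(x(1),\dots,x(p))$, $x(s)\in\mathbb{R}^{n_s}$, $\sum_sn_s=n$; $U_s\in\mathbb{R}^{n\times n_s}$ is the $s$-th block-column of $I_n$ and $\nabla_sf(x)=U_s^T\nabla f(x)$. Define $g^s_{\alpha(-f)}(x)=x+\alpha U_s\nabla_s f(x)$; for $0<\alpha<1/L$ the map $g_{\alpha(-f)}$ is a diffeomorphism (its inverse is the PBCD iteration map). A strict saddle point is $x^*$ with $\nabla f(x^* )=0$ and $\lambda_{\min}(\nabla^2f(x^* ))<0$. *)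

theory Defs
  imports "HOL-Analysis.Analysis"
begin

text \<open>Block-coordinate gradient step g^s_{alpha(-f)}(x) = x + alpha U_s grad_s f(x),
  where the block s is given as a set S of coordinates.\<close>
definition block_step ::
  "real \<Rightarrow> (real^'n \<Rightarrow> real^'n) \<Rightarrow> 'n set \<Rightarrow> real^'n \<Rightarrow> real^'n" where
  "block_step \<alpha> gradf S x = x + \<alpha> *\<^sub>R (\<chi> i. if i \<in> S then gradf x $ i else 0)"

text \<open>g_{alpha(-f)} = g^1 \<circ> ... \<circ> g^p for the ordered list of blocks [B1,...,Bp].\<close>
definition block_map ::
  "real \<Rightarrow> (real^'n \<Rightarrow> real^'n) \<Rightarrow> 'n set list \<Rightarrow> real^'n \<Rightarrow> real^'n" where
  "block_map \<alpha> gradf Bs = foldr (\<lambda>S h. block_step \<alpha> gradf S \<circ> h) Bs id"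

text \<open>Ordered partition of the coordinate set into nonempty disjoint blocks.\<close>
definition block_partition :: "'n set list \<Rightarrow> bool" where
  "block_partition Bs \<longleftrightarrow> (\<forall>S \<in> set Bs. S \<noteq> {}) \<and>
     (\<forall>i<length Bs. \<forall>j<length Bs. i \<noteq> j \<longrightarrow> Bs ! i \<inter> Bs ! j = {}) \<and>
     \<Union>(set Bs) = UNIV"

text \<open>Real eigenvalues of a real square matrix and the smallest one.\<close>
definition real_eigenvalues :: "real^'n^'n \<Rightarrow> real set" where
  "real_eigenvalues A = {c. \<exists>v. v \<noteq> 0 \<and> A *v v = c *\<^sub>R v}"

definition lambda_min :: "real^'n^'n \<Rightarrow> real" where
  "lambda_min A = Min (real_eigenvalues A)"

text \<open>(Complex) eigenvalues of a real square matrix.\<close>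
definition complex_eigenvalues :: "real^'n^'n \<Rightarrow> complex set" where
  "complex_eigenvalues A =
     {\<mu>. \<exists>v :: complex^'n. v \<noteq> 0 \<and> (\<chi> i j. complex_of_real (A $ i $ j)) *v v = \<mu> *s v}"

end

(*
  At the critical point x* the PBCD map g = g^1 o ... o g^p has Jacobian
  M = (I + alpha P_1 H) ... (I + alpha P_p H), where H is the Hessian at x* and P_s the
  coordinate projection onto block s, and inv g has Jacobian J = M^-1. Because alpha L < 1,
  every factor increases the quadratic form q(x) = x . H x, strictly unless it fixes x;
  hence q(J x) <= q(x), with equality only on ker H, on which J is the identity.

  Modulo ker H the powers of J are those of R = (I - E) J for a projection E onto ker H.
  If every eigenvalue of R lay in the open unit disc, then
  q(v) >= q(J^k v) = q(R^k (v - E v)) -> 0 for all v, contradicting the negative curvature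
  at the strict saddle. An eigenvalue of R of modulus >= 1 spans a plane on which q(J x) + q(J y) is
  q(x) + q(y) scaled by |mu|^2, which strict descent forces to exceed one; shifting the
  eigenvector by a vector of ker H turns it into an eigenvector of J.
*)
theory Submission
  imports Defs "Jordan_Normal_Form.Spectral_Radius"
begin

(* The Jordan normal form library reuses the notation of Cartesian vectors. *)
no_notation vec_index (infixl "$" 100)
no_notation scalar_prod (infix "\<bullet>" 70)
unbundle no m_inv_syntax

section \<open>Complexified real matrices\<close>

definition cvec :: "real^'n \<Rightarrow> real^'n \<Rightarrow> complex^'n" where
  "cvec x y = (\<chi> i. Complex (x $ i) (y $ i))"

definition cmat :: "real^'n^'n \<Rightarrow> complex^'n^'n" where
  "cmat A = (\<chi> i j. complex_of_real (A $ i $ j))"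

definition cart_eigenvalues :: "'a::field^'n^'n \<Rightarrow> 'a set" where
  "cart_eigenvalues A = {\<mu>. \<exists>v. v \<noteq> 0 \<and> A *v v = \<mu> *s v}"

lemma complex_eigenvalues_cmat: "complex_eigenvalues A = cart_eigenvalues (cmat A)"
  by (simp add: complex_eigenvalues_def cart_eigenvalues_def cmat_def)

lemma cvec_component [simp]: "cvec x y $ i = Complex (x $ i) (y $ i)"
  by (simp add: cvec_def)

lemma cvec_eq_iff: "cvec x y = cvec x' y' \<longleftrightarrow> x = x' \<and> y = y'"
  by (auto simp: Finite_Cartesian_Product.vec_eq_iff complex_eq_iff)

lemma cvec_eq_0_iff: "cvec x y = 0 \<longleftrightarrow> x = 0 \<and> y = 0"
  by (auto simp: Finite_Cartesian_Product.vec_eq_iff complex_eq_iff)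

lemma cvec_Re_Im: "cvec (\<chi> i. Re (z $ i)) (\<chi> i. Im (z $ i)) = z"
  by (simp add: Finite_Cartesian_Product.vec_eq_iff complex_eq_iff)

lemma cvec_add: "cvec x y + cvec x' y' = cvec (x + x') (y + y')"
  by (simp add: Finite_Cartesian_Product.vec_eq_iff complex_eq_iff)

lemma scalar_mult_cvec:
  "c *s cvec x y = cvec (Re c *\<^sub>R x - Im c *\<^sub>R y) (Im c *\<^sub>R x + Re c *\<^sub>R y)"
  by (simp add: Finite_Cartesian_Product.vec_eq_iff complex_eq_iff)

lemma cmat_mult_cvec: "cmat A *v cvec x y = cvec (A *v x) (A *v y)"
  by (simp add: Finite_Cartesian_Product.vec_eq_iff complex_eq_iff matrix_vector_mult_def cmat_def Re_sum Im_sum)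

lemma norm_le_norm_cvec: "norm x \<le> norm (cvec x y)"
proof (rule norm_le_componentwise_cart)
  fix i
  show "norm (x $ i) \<le> norm (cvec x y $ i)"
    using abs_Re_le_cmod[of "cvec x y $ i"] by simp
qed

lemma ex_complex_vector_iff: "(\<exists>z. P z) \<longleftrightarrow> (\<exists>x y. P (cvec x y))"
  by (metis cvec_Re_Im)

lemma complex_eigenvalues_iff_rotation_pair:
  "\<mu> \<in> complex_eigenvalues A \<longleftrightarrow> (\<exists>x y. (x \<noteq> 0 \<or> y \<noteq> 0) \<and>
     A *v x = Re \<mu> *\<^sub>R x - Im \<mu> *\<^sub>R y \<and> A *v y = Im \<mu> *\<^sub>R x + Re \<mu> *\<^sub>R y)"
  unfolding complex_eigenvalues_cmat cart_eigenvalues_def mem_Collect_eq ex_complex_vector_iff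
  by (simp only: cmat_mult_cvec scalar_mult_cvec cvec_eq_iff cvec_eq_0_iff de_Morgan_conj)

lemma real_eigenvalue_imp_complex_eigenvalue:
  assumes "c \<in> real_eigenvalues A"
  shows "complex_of_real c \<in> complex_eigenvalues A"
proof -
  obtain v where v: "v \<noteq> 0" "A *v v = c *\<^sub>R v"
    using assms unfolding real_eigenvalues_def by blast
  have "A *v v = Re (complex_of_real c) *\<^sub>R v - Im (complex_of_real c) *\<^sub>R 0"
    using v(2) by simp
  moreover have "A *v 0 = Im (complex_of_real c) *\<^sub>R v + Re (complex_of_real c) *\<^sub>R 0"
    by simp
  ultimately show ?thesis
    using v(1) unfolding complex_eigenvalues_iff_rotation_pair
    by (intro exI[of _ v] exI[of _ "0::real^'n"] conjI disjI1)
qed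

section \<open>Spectra via the Jordan normal form library\<close>

text \<open>Matrices of the Jordan normal form library are indexed by natural numbers; we transfer
  along an arbitrary enumeration of the finite index type.\<close>

definition nat_to_index :: "nat \<Rightarrow> 'n::finite" where
  "nat_to_index = (SOME h. bij_betw h {0..<CARD('n)} UNIV)"

definition index_to_nat :: "'n::finite \<Rightarrow> nat" where
  "index_to_nat = inv_into {0..<CARD('n)} nat_to_index"

lemma bij_nat_to_index: "bij_betw (nat_to_index :: nat \<Rightarrow> 'n::finite) {0..<CARD('n)} UNIV"
proof -
  have "\<exists>h. bij_betw h {0..<CARD('n)} (UNIV :: 'n set)"
    by (rule ex_bij_betw_nat_finite) simp
  then show ?thesis unfolding nat_to_index_def by (rule someI_ex)
qed

lemma index_to_nat_less: "index_to_nat (i :: 'n::finite) < CARD('n)"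
  using bij_nat_to_index[where 'n='n] unfolding index_to_nat_def bij_betw_def
  by (metis UNIV_I atLeastLessThan_iff inv_into_into)

lemma nat_to_index_to_nat [simp]: "nat_to_index (index_to_nat (i :: 'n::finite)) = i"
  using bij_nat_to_index[where 'n='n] unfolding index_to_nat_def bij_betw_def
  by (simp add: f_inv_into_f)

lemma index_to_nat_to_index [simp]: "j < CARD('n::finite) \<Longrightarrow> index_to_nat (nat_to_index j :: 'n) = j"
  using bij_nat_to_index[where 'n='n] unfolding index_to_nat_def bij_betw_def
  by (simp add: inv_into_f_f)

definition mat_of_cart :: "'a^'n::finite^'n \<Rightarrow> 'a mat" where
  "mat_of_cart A = mat CARD('n) CARD('n) (\<lambda>(i, j). A $ nat_to_index i $ nat_to_index j)"

definition vec_of_cart :: "'a^'n::finite \<Rightarrow> 'a Matrix.vec" where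
  "vec_of_cart x = Matrix.vec CARD('n) (\<lambda>i. x $ nat_to_index i)"

lemma mat_of_cart_carrier: "mat_of_cart (A :: 'a^'n::finite^'n) \<in> carrier_mat CARD('n) CARD('n)"
  by (simp add: mat_of_cart_def)

lemma vec_of_cart_carrier: "vec_of_cart (x :: 'a^'n::finite) \<in> carrier_vec CARD('n)"
  by (simp add: vec_of_cart_def)

lemma vec_of_cart_index: "vec_index (vec_of_cart x) (index_to_nat i) = x $ i"
  by (simp add: vec_of_cart_def index_to_nat_less)

lemma vec_of_cart_eq_iff: "vec_of_cart x = vec_of_cart y \<longleftrightarrow> x = y"
  by (metis Finite_Cartesian_Product.vec_eq_iff vec_of_cart_index)

lemma vec_of_cart_surj:
  assumes "v \<in> carrier_vec CARD('n::finite)"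
  shows "v = vec_of_cart (\<chi> i :: 'n. vec_index v (index_to_nat i))"
  using assms by (intro eq_vecI) (simp_all add: vec_of_cart_def)

lemma vec_of_cart_0: "vec_of_cart (0 :: 'a::zero^'n::finite) = 0\<^sub>v CARD('n)"
  by (intro eq_vecI) (simp_all add: vec_of_cart_def)

lemma vec_of_cart_smult: "vec_of_cart (c *s x) = c \<cdot>\<^sub>v vec_of_cart x"
  by (intro eq_vecI) (simp_all add: vec_of_cart_def)

lemma mat_of_cart_mult_vec:
  fixes A :: "'a::comm_semiring_1^'n::finite^'n"
  shows "mat_of_cart A *\<^sub>v vec_of_cart x = vec_of_cart (A *v x)"
proof (rule eq_vecI)
  fix i assume "i < dim_vec (vec_of_cart (A *v x))"
  then have i: "i < CARD('n)" by (simp add: vec_of_cart_def)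
  have "vec_index (mat_of_cart A *\<^sub>v vec_of_cart x) i =
      (\<Sum>j = 0..<CARD('n). A $ nat_to_index i $ nat_to_index j * x $ nat_to_index j)"
    using i by (simp add: mat_of_cart_def vec_of_cart_def scalar_prod_def)
  also have "\<dots> = (\<Sum>j\<in>UNIV. A $ nat_to_index i $ j * x $ j)"
    by (rule sum.reindex_bij_betw[OF bij_nat_to_index])
  finally show "vec_index (mat_of_cart A *\<^sub>v vec_of_cart x) i = vec_index (vec_of_cart (A *v x)) i"
    using i by (simp add: vec_of_cart_def matrix_vector_mult_def)
qed (simp add: mat_of_cart_def vec_of_cart_def)

lemma mat_of_cart_pow_mult_vec:
  fixes A :: "'a::comm_semiring_1^'n::finite^'n"
  shows "(mat_of_cart A ^\<^sub>m k) *\<^sub>v vec_of_cart x = vec_of_cart (((*v) A ^^ k) x)"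
proof (induction k arbitrary: x)
  case 0
  show ?case using vec_of_cart_carrier[of x] by (simp add: mat_of_cart_def)
next
  case (Suc k)
  have "(mat_of_cart A ^\<^sub>m Suc k) *\<^sub>v vec_of_cart x = (mat_of_cart A ^\<^sub>m k * mat_of_cart A) *\<^sub>v vec_of_cart x"
    by simp
  also have "\<dots> = (mat_of_cart A ^\<^sub>m k) *\<^sub>v (mat_of_cart A *\<^sub>v vec_of_cart x)"
    by (rule assoc_mult_mat_vec[OF pow_carrier_mat mat_of_cart_carrier vec_of_cart_carrier])
      (rule mat_of_cart_carrier)
  finally have "(mat_of_cart A ^\<^sub>m Suc k) *\<^sub>v vec_of_cart x = (mat_of_cart A ^\<^sub>m k) *\<^sub>v (mat_of_cart A *\<^sub>v vec_of_cart x)" .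
  then show ?case
    unfolding funpow_Suc_right comp_def by (simp only: mat_of_cart_mult_vec Suc)
qed

lemma ex_carrier_vec_iff:
  "(\<exists>v \<in> carrier_vec CARD('n::finite). P v) \<longleftrightarrow> (\<exists>x :: 'a^'n. P (vec_of_cart x))"
proof
  assume "\<exists>v \<in> carrier_vec CARD('n). P v"
  then obtain v where "v \<in> carrier_vec CARD('n)" "P v" by blast
  then show "\<exists>x :: 'a^'n. P (vec_of_cart x)" using vec_of_cart_surj by metis
qed (use vec_of_cart_carrier in blast)

lemma spectrum_mat_of_cart: "spectrum (mat_of_cart (A :: 'a::field^'n::finite^'n)) = cart_eigenvalues A"
proof (rule Set.set_eqI)
  fix \<mu>
  have "\<mu> \<in> spectrum (mat_of_cart A) \<longleftrightarrow>
      (\<exists>v \<in> carrier_vec CARD('n). v \<noteq> 0\<^sub>v CARD('n) \<and> mat_of_cart A *\<^sub>v v = \<mu> \<cdot>\<^sub>v v)"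
    by (auto simp: spectrum_def eigenvalue_def eigenvector_def mat_of_cart_def)
  also have "\<dots> \<longleftrightarrow> (\<exists>x. vec_of_cart x \<noteq> 0\<^sub>v CARD('n) \<and>
      mat_of_cart A *\<^sub>v vec_of_cart x = \<mu> \<cdot>\<^sub>v vec_of_cart (x :: 'a^'n))"
    by (rule ex_carrier_vec_iff)
  also have "\<dots> \<longleftrightarrow> \<mu> \<in> cart_eigenvalues A"
    by (simp add: cart_eigenvalues_def mat_of_cart_mult_vec vec_of_cart_eq_iff
        flip: vec_of_cart_0 vec_of_cart_smult)
  finally show "\<mu> \<in> spectrum (mat_of_cart A) \<longleftrightarrow> \<mu> \<in> cart_eigenvalues A" .
qed

lemma finite_cart_eigenvalues: "finite (cart_eigenvalues (A :: 'a::field^'n::finite^'n))"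
  using card_finite_spectrum(1)[OF mat_of_cart_carrier] by (simp add: spectrum_mat_of_cart)

lemma cart_eigenvalues_nonempty: "cart_eigenvalues (A :: complex^'n::finite^'n) \<noteq> {}"
  using spectrum_non_empty[OF mat_of_cart_carrier] by (simp add: spectrum_mat_of_cart)

lemma scaleR_matrix_mult_vec:
  fixes A :: "'a::real_algebra_1^'n^'m"
  shows "(c *\<^sub>R A) *v z = c *\<^sub>R (A *v z)" and "A *v (c *\<^sub>R z) = c *\<^sub>R (A *v z)"
  by (simp_all add: Finite_Cartesian_Product.vec_eq_iff matrix_vector_mult_def scaleR_sum_right)

lemma norm_powers_component_le:
  fixes A :: "complex^'n^'n"
  assumes "norm_bound (mat_of_cart A ^\<^sub>m k) c"
  shows "norm (((*v) A ^^ k) z $ i) \<le> c * (\<Sum>j\<in>UNIV. norm (z $ j))"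
proof -
  let ?P = "mat_of_cart A ^\<^sub>m k"
  have P: "?P \<in> carrier_mat CARD('n) CARD('n)"
    by (rule pow_carrier_mat[OF mat_of_cart_carrier])
  have "((*v) A ^^ k) z $ i = vec_index (?P *\<^sub>v vec_of_cart z) (index_to_nat i)"
    by (simp add: mat_of_cart_pow_mult_vec vec_of_cart_index)
  also have "\<dots> = (\<Sum>j = 0..<CARD('n). ?P $$ (index_to_nat i, j) * z $ nat_to_index j)"
    using index_to_nat_less[of i] carrier_matD[OF P]
    by (subst index_mult_mat_vec) (auto simp: vec_of_cart_def scalar_prod_def intro!: sum.cong)
  also have "\<dots> = (\<Sum>j = 0..<CARD('n).
      (\<lambda>l. ?P $$ (index_to_nat i, index_to_nat l) * z $ l) (nat_to_index j))"
    by (intro sum.cong) auto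
  also have "\<dots> = (\<Sum>l\<in>UNIV. ?P $$ (index_to_nat i, index_to_nat l) * z $ l)"
    by (rule sum.reindex_bij_betw[OF bij_nat_to_index])
  finally have "norm (((*v) A ^^ k) z $ i) \<le>
      (\<Sum>j\<in>UNIV. norm (?P $$ (index_to_nat i, index_to_nat j)) * norm (z $ j))"
    by (metis (no_types, lifting) norm_mult norm_sum sum.cong)
  also have "\<dots> \<le> (\<Sum>j\<in>UNIV. c * norm (z $ j))"
    using assms index_to_nat_less[where 'n='n]
    by (intro sum_mono mult_right_mono) (auto simp: norm_bound_def mat_of_cart_def)
  finally show ?thesis
    by (simp add: sum_distrib_left)
qed

lemma bounded_powers_if_eigenvalues_lt_1:
  fixes A :: "complex^'n^'n"
  assumes "\<forall>\<mu> \<in> cart_eigenvalues A. norm \<mu> < 1"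
  shows "bounded (range (\<lambda>k. ((*v) A ^^ k) z))"
proof -
  have "spectral_radius (mat_of_cart A) \<in> norm ` cart_eigenvalues A"
    using spectral_radius_mem_max(1)[OF mat_of_cart_carrier[of A]] by (simp add: spectrum_mat_of_cart)
  with assms have "spectral_radius (mat_of_cart A) < 1"
    by auto
  then obtain c where c: "\<And>k. norm_bound (mat_of_cart A ^\<^sub>m k) c"
    using spectral_radius_jnf_norm_bound_less_1_upper_triangular[OF mat_of_cart_carrier] by blast
  define C where "C = c * (\<Sum>j\<in>UNIV. norm (z $ j))"
  have "norm (((*v) A ^^ k) z) \<le> CARD('n) * C" for k
  proof -
    have "norm (((*v) A ^^ k) z) \<le> (\<Sum>i\<in>UNIV. norm (((*v) A ^^ k) z $ i))"
      by (simp add: norm_vec_def L2_set_le_sum)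
    also have "\<dots> \<le> (\<Sum>i\<in>(UNIV :: 'n set). C)"
      unfolding C_def by (intro sum_mono norm_powers_component_le c)
    finally show ?thesis
      by simp
  qed
  then show ?thesis
    by (auto simp: bounded_iff)
qed

lemma exists_scale_gt_1:
  fixes S :: "real set"
  assumes "finite S" and "\<And>s. s \<in> S \<Longrightarrow> s < 1"
  obtains t where "1 < t" and "\<And>s. s \<in> S \<Longrightarrow> t * s < 1"
proof -
  define m where "m = Max (insert 0 S)"
  have m: "0 \<le> m" "\<And>s. s \<in> S \<Longrightarrow> s \<le> m"
    using assms(1) by (simp_all add: m_def)
  have "m \<in> insert 0 S"
    unfolding m_def using assms(1) by (intro Max_in) auto
  then have "m < 1"
    using assms(2) by auto
  show ?thesis
  proof
    show "1 < 2 / (1 + m)"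
      using m(1) \<open>m < 1\<close> by (simp add: divide_simps)
    show "2 / (1 + m) * s < 1" if "s \<in> S" for s
    proof -
      have "2 / (1 + m) * s \<le> 2 / (1 + m) * m"
        using m that by (intro mult_left_mono) simp_all
      also have "\<dots> < 1"
        using m(1) \<open>m < 1\<close> by (simp add: divide_simps)
      finally show ?thesis .
    qed
  qed
qed

lemma cart_eigenvalues_scaleR:
  fixes A :: "complex^'n^'n"
  assumes "\<mu> \<in> cart_eigenvalues (t *\<^sub>R A)" and "t \<noteq> 0"
  shows "\<mu> / complex_of_real t \<in> cart_eigenvalues A"
proof -
  obtain v where v: "v \<noteq> 0" "t *\<^sub>R (A *v v) = \<mu> *s v"
    using assms(1) unfolding cart_eigenvalues_def mem_Collect_eq scaleR_matrix_mult_vec by blast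
  have "(A *v v) $ i = \<mu> / complex_of_real t * v $ i" for i
    using arg_cong[OF v(2), of "\<lambda>u. u $ i"] assms(2)
    unfolding vector_scaleR_component vector_smult_component
    by (simp add: scaleR_conv_of_real field_simps)
  then have "A *v v = (\<mu> / complex_of_real t) *s v"
    by (simp add: Finite_Cartesian_Product.vec_eq_iff)
  with v(1) show ?thesis
    unfolding cart_eigenvalues_def by blast
qed

text \<open>Bounded powers of \<open>t A\<close> for some \<open>t > 1\<close> give geometric decay of the powers of \<open>A\<close>.\<close>

lemma powers_tendsto_0_if_eigenvalues_lt_1:
  fixes A :: "complex^'n^'n"
  assumes "\<forall>\<mu> \<in> cart_eigenvalues A. norm \<mu> < 1"
  shows "(\<lambda>k. ((*v) A ^^ k) z) \<longlonglongrightarrow> 0"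
proof -
  have "finite (norm ` cart_eigenvalues A)"
    by (simp add: finite_cart_eigenvalues)
  then obtain t where t: "1 < t" "\<And>s. s \<in> norm ` cart_eigenvalues A \<Longrightarrow> t * s < 1"
    by (rule exists_scale_gt_1) (use assms in auto)
  have "norm \<mu> < 1" if "\<mu> \<in> cart_eigenvalues (t *\<^sub>R A)" for \<mu>
  proof -
    have "t * norm (\<mu> / complex_of_real t) < 1"
      using t(1) by (intro t(2) imageI cart_eigenvalues_scaleR[OF that]) simp
    with t(1) show ?thesis
      by (simp add: norm_divide)
  qed
  then obtain C where C: "\<And>k. norm (((*v) (t *\<^sub>R A) ^^ k) z) \<le> C"
    using bounded_powers_if_eigenvalues_lt_1[of "t *\<^sub>R A" z] unfolding bounded_iff by blast
  have scaled: "((*v) (t *\<^sub>R A) ^^ k) z = t ^ k *\<^sub>R ((*v) A ^^ k) z" for k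
    by (induction k) (simp_all add: scaleR_matrix_mult_vec)
  have bound: "norm (((*v) A ^^ k) z) \<le> C * inverse t ^ k" for k
  proof -
    have "t ^ k * norm (((*v) A ^^ k) z) \<le> C"
      using C[of k] t(1) by (simp add: scaled)
    then show ?thesis
      using t(1) by (simp add: power_inverse divide_simps mult.commute)
  qed
  have "norm (inverse t) < 1"
    using t(1) by (simp add: inverse_less_1_iff)
  then have "(\<lambda>k. C * inverse t ^ k) \<longlonglongrightarrow> 0"
    by (intro tendsto_mult_right_zero LIMSEQ_power_zero)
  then show ?thesis
    by (rule Lim_null_comparison[OF always_eventually[OF allI[OF bound]]])
qed

lemma cmat_powers_cvec: "((*v) (cmat A) ^^ k) (cvec x y) = cvec (((*v) A ^^ k) x) (((*v) A ^^ k) y)"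
  by (induction k) (simp_all add: cmat_mult_cvec)

lemma powers_tendsto_0_if_complex_eigenvalues_lt_1:
  assumes "\<forall>\<mu> \<in> complex_eigenvalues A. norm \<mu> < 1"
  shows "(\<lambda>k. ((*v) A ^^ k) x) \<longlonglongrightarrow> 0"
proof (rule Lim_null_comparison[OF always_eventually])
  show "\<forall>k. norm (((*v) A ^^ k) x) \<le> norm (((*v) (cmat A) ^^ k) (cvec x 0))"
    by (simp add: cmat_powers_cvec norm_le_norm_cvec)
  show "(\<lambda>k. norm (((*v) (cmat A) ^^ k) (cvec x 0))) \<longlonglongrightarrow> 0"
    using assms by (intro tendsto_norm_zero powers_tendsto_0_if_eigenvalues_lt_1)
      (simp add: complex_eigenvalues_cmat)
qed

lemma finite_real_eigenvalues: "finite (real_eigenvalues A)"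
proof (rule finite_subset)
  show "real_eigenvalues A \<subseteq> Re ` complex_eigenvalues A"
    using real_eigenvalue_imp_complex_eigenvalue by force
  show "finite (Re ` complex_eigenvalues A)"
    unfolding complex_eigenvalues_cmat by (rule finite_imageI[OF finite_cart_eigenvalues])
qed

lemma self_adjoint_real_eigenvalues_nonempty:
  assumes sym: "\<And>x y. (A *v x) \<bullet> y = x \<bullet> (A *v y)"
  shows "real_eigenvalues A \<noteq> {}"
proof -
  obtain \<mu> where "\<mu> \<in> complex_eigenvalues A"
    using cart_eigenvalues_nonempty by (auto simp: complex_eigenvalues_cmat)
  then obtain x y where ne: "x \<noteq> 0 \<or> y \<noteq> 0"
    and Ax: "A *v x = Re \<mu> *\<^sub>R x - Im \<mu> *\<^sub>R y" and Ay: "A *v y = Im \<mu> *\<^sub>R x + Re \<mu> *\<^sub>R y"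
    unfolding complex_eigenvalues_iff_rotation_pair by blast
  have "Im \<mu> * (x \<bullet> x + y \<bullet> y) = 0"
    using sym[of x y] unfolding Ax Ay by (simp add: algebra_simps inner_commute)
  moreover have "x \<bullet> x + y \<bullet> y > 0"
    using ne by (metis add_nonneg_pos add_pos_nonneg inner_ge_zero inner_gt_zero_iff)
  ultimately have "Im \<mu> = 0" by simp
  then have "A *v x = Re \<mu> *\<^sub>R x" "A *v y = Re \<mu> *\<^sub>R y"
    using Ax Ay by simp_all
  with ne have "Re \<mu> \<in> real_eigenvalues A"
    unfolding real_eigenvalues_def by blast
  then show ?thesis by blast
qed

lemma lambda_min_eigenvector:
  assumes "\<And>x y. (A *v x) \<bullet> y = x \<bullet> (A *v y)"
  obtains v where "v \<noteq> 0" "A *v v = lambda_min A *\<^sub>R v"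
proof -
  have "lambda_min A \<in> real_eigenvalues A"
    unfolding lambda_min_def
    by (rule Min_in[OF finite_real_eigenvalues self_adjoint_real_eigenvalues_nonempty[OF assms]])
  then show ?thesis using that unfolding real_eigenvalues_def by blast
qed

section \<open>A quadratic Lyapunov function for the inverse Jacobian\<close>

lemma linear_projection_onto_subspace:
  fixes S :: "'a::euclidean_space set"
  assumes "Real_Vector_Spaces.subspace S"
  obtains E where "linear E" "\<And>x. E x \<in> S" "\<And>x. x \<in> S \<Longrightarrow> E x = x"
proof -
  obtain B where B: "pairwise real_inner_class.orthogonal B" "\<And>b. b \<in> B \<Longrightarrow> norm b = 1"
    "independent B" "Real_Vector_Spaces.span B = S"
    using orthonormal_basis_subspace[OF assms] by metis
  have fin: "finite B"
    using B(3) by (rule independent_imp_finite)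
  define E where "E x = (\<Sum>b\<in>B. (x \<bullet> b) *\<^sub>R b)" for x
  have lin: "linear E"
    unfolding E_def by (intro linearI)
      (simp_all add: inner_add_left scaleR_add_left sum.distrib scaleR_sum_right)
  have range: "E x \<in> S" for x
    unfolding E_def B(4)[symmetric] by (intro span_sum span_scale span_base)
  have "E b = b" if b: "b \<in> B" for b
  proof -
    have "(b \<bullet> b') *\<^sub>R b' = (if b' = b then b else 0)" if "b' \<in> B" for b'
      using B(1,2) b that by (auto simp: norm_eq_1 real_inner_class.orthogonal_def pairwise_def inner_commute)
    then show ?thesis
      using fin b by (simp add: E_def)
  qed
  then have "E x = x" if "x \<in> S" for x
    using linear_eq_on_span[OF lin linear_id, of B x] that by (simp add: B(4))
  with lin range show ?thesis using that by blast
qed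

lemma eigenvector_shift:
  fixes A :: "'a::field^'n^'n"
  assumes "A *v w = \<mu> *s w + k" and "A *v k = k" and "\<mu> \<noteq> 1"
  shows "A *v (w + (1 / (\<mu> - 1)) *s k) = \<mu> *s (w + (1 / (\<mu> - 1)) *s k)"
proof -
  have "1 + 1 / (\<mu> - 1) = \<mu> * (1 / (\<mu> - 1))"
    using assms(3) by (simp add: divide_simps)
  then have "k + (1 / (\<mu> - 1)) *s k = (\<mu> * (1 / (\<mu> - 1))) *s k"
    by (metis vector_sadd_rdistrib vector_smult_lid)
  then show ?thesis
    using assms(1,2) by (simp add: matrix_vector_right_distrib vector_scalar_commute
        vector_add_ldistrib vector_smult_assoc add.assoc)
qed

definition quad_form :: "real^'n^'n \<Rightarrow> real^'n \<Rightarrow> real" where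
  "quad_form H x = x \<bullet> (H *v x)"

lemma quad_form_add_kernel:
  assumes self_adjoint: "\<And>x y. (H *v x) \<bullet> y = x \<bullet> (H *v y)" and "H *v k = 0"
  shows "quad_form H (x + k) = quad_form H x" and "quad_form H (x - k) = quad_form H x"
  using self_adjoint[of k x] assms(2)
  by (simp_all add: quad_form_def matrix_vector_right_distrib matrix_vector_mult_diff_distrib
      inner_add_left inner_diff_left)

lemma quad_form_rotation:
  assumes self_adjoint: "\<And>x y. (H *v x) \<bullet> y = x \<bullet> (H *v y)"
  shows "quad_form H (a *\<^sub>R x - b *\<^sub>R y) + quad_form H (b *\<^sub>R x + a *\<^sub>R y) =
    (a\<^sup>2 + b\<^sup>2) * (quad_form H x + quad_form H y)"
  using self_adjoint[of x y]
  by (simp add: quad_form_def matrix_vector_right_distrib matrix_vector_mult_diff_distrib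
      matrix_vector_mult_scaleR inner_add_left inner_add_right inner_diff_left inner_diff_right
      inner_commute power2_eq_square algebra_simps)

locale quadratic_descent =
  fixes J H :: "real^'n^'n"
  assumes self_adjoint: "\<And>x y. (H *v x) \<bullet> y = x \<bullet> (H *v y)"
    and descent: "\<And>x. quad_form H (J *v x) \<le> quad_form H x"
    and descent_strict: "\<And>x. quad_form H x \<le> quad_form H (J *v x) \<Longrightarrow> H *v x = 0"
    and fixes_kernel: "\<And>k. H *v k = 0 \<Longrightarrow> J *v k = k"

locale quadratic_descent_projection = quadratic_descent J H for J H :: "real^'n^'n" +
  fixes E :: "real^'n \<Rightarrow> real^'n"
  assumes linear_E: "linear E"
    and kernel_E: "\<And>x. H *v E x = 0"
    and E_kernel: "\<And>k. H *v k = 0 \<Longrightarrow> E k = k"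
begin

text \<open>\<open>R\<close> discards the component in \<open>ker H\<close>, where \<open>J\<close> is the identity but may still have
  nontrivial Jordan blocks; modulo \<open>ker H\<close> the powers of \<open>R\<close> are those of \<open>J\<close>.\<close>

definition R :: "real^'n^'n" where
  "R = J - matrix E ** J"

lemma R_apply: "R *v x = J *v x - E (J *v x)"
  using fun_cong[OF matrix_vector_mul(2)[OF linear_E]]
  by (simp add: R_def matrix_vector_mult_diff_rdistrib matrix_vector_mul_assoc[symmetric])

lemma E_R: "E (R *v x) = 0"
  by (simp add: R_apply linear_diff[OF linear_E] E_kernel[OF kernel_E])

lemma quad_form_nonneg_if_R_stable:
  assumes "\<forall>\<mu> \<in> complex_eigenvalues R. norm \<mu> < 1"
  shows "0 \<le> quad_form H v"
proof -
  define u where "u k = ((*v) J ^^ k) v" for k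
  define w where "w k = u k - E (u k)" for k
  have w_iter: "w k = ((*v) R ^^ k) (w 0)" for k
  proof (induction k)
    case (Suc k)
    have "J *v E (u k) = E (u k)"
      using fixes_kernel[OF kernel_E] .
    then have "R *v w k = w (Suc k)"
      by (simp add: w_def u_def R_apply matrix_vector_mult_diff_distrib linear_diff[OF linear_E]
          E_kernel[OF kernel_E])
    with Suc show ?case by simp
  qed simp
  have "(\<lambda>k. ((*v) R ^^ k) (w 0)) = w"
    by (intro ext) (rule w_iter[symmetric])
  then have "w \<longlonglongrightarrow> 0"
    using powers_tendsto_0_if_complex_eigenvalues_lt_1[OF assms, of "w 0"] by simp
  then have lim: "(\<lambda>k. quad_form H (w k)) \<longlonglongrightarrow> quad_form H 0"
    unfolding quad_form_def by (intro tendsto_inner bounded_linear.tendsto[OF matrix_vector_mul_bounded_linear])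
  have bound: "quad_form H (w k) \<le> quad_form H v" for k
  proof -
    have "quad_form H (w k) = quad_form H (u k)"
      by (simp add: w_def quad_form_add_kernel(2)[OF self_adjoint kernel_E])
    also have "\<dots> \<le> quad_form H v"
      by (induction k) (auto simp: u_def intro: order_trans[OF descent])
    finally show ?thesis .
  qed
  have "quad_form H 0 \<le> quad_form H v"
    using bound by (intro LIMSEQ_le_const2[OF lim]) blast
  then show ?thesis by (simp add: quad_form_def)
qed

lemma eq_0_if_kernel_E_eq_0:
  assumes "H *v x = 0" and "E x = 0"
  shows "x = 0"
  using E_kernel[OF assms(1)] assms(2) by simp

context
  fixes a b :: real and x y :: "real^'n"
  assumes Rx: "R *v x = a *\<^sub>R x - b *\<^sub>R y" and Ry: "R *v y = b *\<^sub>R x + a *\<^sub>R y"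
begin

lemma rotation_pair_E_eq_0:
  assumes "a\<^sup>2 + b\<^sup>2 \<noteq> 0"
  shows "E x = 0" and "E y = 0"
proof -
  have h: "a *\<^sub>R E x - b *\<^sub>R E y = 0" "b *\<^sub>R E x + a *\<^sub>R E y = 0"
    using E_R[of x] E_R[of y] unfolding Rx Ry
    by (simp_all add: linear_diff[OF linear_E] linear_add[OF linear_E] linear_scale[OF linear_E])
  have "(a\<^sup>2 + b\<^sup>2) *\<^sub>R E x = a *\<^sub>R (a *\<^sub>R E x - b *\<^sub>R E y) + b *\<^sub>R (b *\<^sub>R E x + a *\<^sub>R E y)"
    by (simp add: algebra_simps power2_eq_square)
  also have "\<dots> = 0"
    by (simp only: h scaleR_zero_right add_0_right)
  finally show "E x = 0"
    using assms scaleR_eq_0_iff by blast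
  have "(a\<^sup>2 + b\<^sup>2) *\<^sub>R E y = a *\<^sub>R (b *\<^sub>R E x + a *\<^sub>R E y) - b *\<^sub>R (a *\<^sub>R E x - b *\<^sub>R E y)"
    by (simp add: algebra_simps power2_eq_square)
  also have "\<dots> = 0"
    by (simp only: h scaleR_zero_right diff_self)
  finally show "E y = 0"
    using assms scaleR_eq_0_iff by blast
qed

lemma J_rotation_pair:
  obtains k1 k2 where "H *v k1 = 0" and "H *v k2 = 0"
    and "J *v x = (a *\<^sub>R x - b *\<^sub>R y) + k1" and "J *v y = (b *\<^sub>R x + a *\<^sub>R y) + k2"
proof
  show "H *v E (J *v x) = 0" "H *v E (J *v y) = 0"
    by (rule kernel_E)+
  show "J *v x = (a *\<^sub>R x - b *\<^sub>R y) + E (J *v x)" "J *v y = (b *\<^sub>R x + a *\<^sub>R y) + E (J *v y)"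
    by (simp_all flip: Rx Ry add: R_apply)
qed

context
  assumes Ex: "E x = 0" and Ey: "E y = 0" and ne: "x \<noteq> 0 \<or> y \<noteq> 0"
begin

lemma rotation_pair_quad_form_less:
  "(a\<^sup>2 + b\<^sup>2) * (quad_form H x + quad_form H y) < quad_form H x + quad_form H y"
proof -
  obtain k1 k2 where k: "H *v k1 = 0" "H *v k2 = 0"
    and Jx: "J *v x = (a *\<^sub>R x - b *\<^sub>R y) + k1" and Jy: "J *v y = (b *\<^sub>R x + a *\<^sub>R y) + k2"
    by (rule J_rotation_pair)
  have "quad_form H (J *v x) + quad_form H (J *v y) = (a\<^sup>2 + b\<^sup>2) * (quad_form H x + quad_form H y)"
    unfolding Jx Jy quad_form_add_kernel(1)[OF self_adjoint k(1)] quad_form_add_kernel(1)[OF self_adjoint k(2)]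
    by (rule quad_form_rotation[OF self_adjoint])
  moreover have "quad_form H (J *v x) + quad_form H (J *v y) < quad_form H x + quad_form H y"
  proof (rule ccontr)
    assume "\<not> ?thesis"
    then have "quad_form H x \<le> quad_form H (J *v x)" "quad_form H y \<le> quad_form H (J *v y)"
      using descent[of x] descent[of y] by linarith+
    then have "x = 0" "y = 0"
      using descent_strict Ex Ey eq_0_if_kernel_E_eq_0 by blast+
    with ne show False
      by simp
  qed
  ultimately show ?thesis
    by simp
qed

lemma rotation_pair_eigenvalue_of_J:
  assumes "Complex a b \<noteq> 1"
  shows "Complex a b \<in> complex_eigenvalues J"
proof -
  obtain k1 k2 where k: "H *v k1 = 0" "H *v k2 = 0"
    and Jx: "J *v x = (a *\<^sub>R x - b *\<^sub>R y) + k1" and Jy: "J *v y = (b *\<^sub>R x + a *\<^sub>R y) + k2"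
    by (rule J_rotation_pair)
  define c where "c = 1 / (Complex a b - 1)"
  define z where "z = cvec x y + c *s cvec k1 k2"
  have "cmat J *v cvec x y = Complex a b *s cvec x y + cvec k1 k2"
    by (simp add: cmat_mult_cvec Jx Jy scalar_mult_cvec cvec_add)
  moreover have "cmat J *v cvec k1 k2 = cvec k1 k2"
    by (simp add: cmat_mult_cvec fixes_kernel k)
  ultimately have "cmat J *v z = Complex a b *s z"
    unfolding z_def c_def using assms by (rule eigenvector_shift)
  moreover have "z \<noteq> 0"
  proof
    assume "z = 0"
    then have "x + (Re c *\<^sub>R k1 - Im c *\<^sub>R k2) = 0" "y + (Im c *\<^sub>R k1 + Re c *\<^sub>R k2) = 0"
      unfolding z_def scalar_mult_cvec cvec_add cvec_eq_0_iff by simp_all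
    then have "H *v (x + (Re c *\<^sub>R k1 - Im c *\<^sub>R k2)) = 0" "H *v (y + (Im c *\<^sub>R k1 + Re c *\<^sub>R k2)) = 0"
      by simp_all
    then have "H *v x = 0" "H *v y = 0"
      by (simp_all add: k matrix_vector_mult_diff_distrib matrix_vector_right_distrib
          matrix_vector_mult_scaleR)
    with Ex Ey ne show False
      using eq_0_if_kernel_E_eq_0 by blast
  qed
  ultimately show ?thesis
    unfolding complex_eigenvalues_cmat cart_eigenvalues_def by blast
qed

end

end

lemma R_eigenvalue_outside_unit_disc:
  assumes "\<mu> \<in> complex_eigenvalues R" and "1 \<le> norm \<mu>"
  shows "\<mu> \<in> complex_eigenvalues J \<and> 1 < norm \<mu>"
proof -
  obtain x y where ne: "x \<noteq> 0 \<or> y \<noteq> 0"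
    and Rx: "R *v x = Re \<mu> *\<^sub>R x - Im \<mu> *\<^sub>R y" and Ry: "R *v y = Im \<mu> *\<^sub>R x + Re \<mu> *\<^sub>R y"
    using assms(1) unfolding complex_eigenvalues_iff_rotation_pair by blast
  have norm2: "(norm \<mu>)\<^sup>2 = (Re \<mu>)\<^sup>2 + (Im \<mu>)\<^sup>2"
    by (rule cmod_power2)
  then have "(Re \<mu>)\<^sup>2 + (Im \<mu>)\<^sup>2 \<noteq> 0"
    using assms(2) by auto
  then have E: "E x = 0" "E y = 0"
    using rotation_pair_E_eq_0[OF Rx Ry] by blast+
  have "norm \<mu> \<noteq> 1"
    using rotation_pair_quad_form_less[OF Rx Ry E ne] norm2 by auto
  with assms(2) have "1 < norm \<mu>"
    by simp
  then have "Complex (Re \<mu>) (Im \<mu>) \<noteq> 1"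
    by auto
  with \<open>1 < norm \<mu>\<close> show ?thesis
    using rotation_pair_eigenvalue_of_J[OF Rx Ry E ne] by simp
qed

end

context quadratic_descent
begin

theorem eigenvalue_outside_unit_disc:
  assumes "quad_form H v < 0"
  shows "\<exists>\<mu> \<in> complex_eigenvalues J. 1 < norm \<mu>"
proof -
  have "Real_Vector_Spaces.subspace {x. H *v x = 0}"
    by (simp add: Real_Vector_Spaces.subspace_def matrix_vector_right_distrib matrix_vector_mult_scaleR)
  then obtain E where "linear E" "\<And>x. H *v E x = 0" "\<And>k. H *v k = 0 \<Longrightarrow> E k = k"
    by (rule linear_projection_onto_subspace) auto
  then interpret quadratic_descent_projection J H E
    by (intro quadratic_descent_projection.intro quadratic_descent_projection_axioms.intro
        quadratic_descent_axioms)
  show ?thesis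
  proof (cases "\<forall>\<mu> \<in> complex_eigenvalues R. norm \<mu> < 1")
    case True
    then have "0 \<le> quad_form H v"
      by (rule quad_form_nonneg_if_R_stable)
    with assms show ?thesis by simp
  next
    case False
    then show ?thesis
      using R_eigenvalue_outside_unit_disc by (meson not_less)
  qed
qed

end

section \<open>The Hessian at a point\<close>

lemma derivative_norm_le_Lipschitz:
  fixes g :: "'a::real_normed_vector \<Rightarrow> 'b::real_normed_vector"
  assumes deriv: "(g has_derivative g') (at x)"
    and lip: "\<And>y. norm (g y - g x) \<le> L * norm (y - x)"
  shows "norm (g' h) \<le> L * norm h"
proof (rule ccontr)
  assume "\<not> ?thesis"
  then have gt: "L * norm h < norm (g' h)" by simp
  have lin: "linear g'"
    using deriv by (rule has_derivative_linear)
  have "h \<noteq> 0"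
    using gt linear_0[OF lin] by auto
  then have h: "0 < norm h" by simp
  define e where "e = (norm (g' h) - L * norm h) / (2 * norm h)"
  have "0 < e"
    using gt h by (simp add: e_def)
  then obtain d where d: "0 < d"
    and approx: "\<And>y. norm (y - x) < d \<Longrightarrow> norm (g y - g x - g' (y - x)) \<le> e * norm (y - x)"
    using deriv unfolding has_derivative_at_alt by blast
  define t where "t = d / (2 * norm h)"
  have t: "0 < t" "norm (t *\<^sub>R h) < d"
    using d h by (simp_all add: t_def)
  have "t * norm (g' h) = norm (g' (t *\<^sub>R h))"
    using t(1) by (simp add: linear_scale[OF lin])
  also have "\<dots> \<le> norm (g (x + t *\<^sub>R h) - g x) + norm (g (x + t *\<^sub>R h) - g x - g' (t *\<^sub>R h))"
    using norm_triangle_ineq4[of "g (x + t *\<^sub>R h) - g x" "g (x + t *\<^sub>R h) - g x - g' (t *\<^sub>R h)"]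
    by simp
  also have "\<dots> \<le> L * (t * norm h) + e * (t * norm h)"
    using lip[of "x + t *\<^sub>R h"] approx[of "x + t *\<^sub>R h"] t by (intro add_mono) simp_all
  also have "\<dots> = t * (L * norm h + e * norm h)"
    by (simp add: algebra_simps)
  finally have "norm (g' h) \<le> L * norm h + e * norm h"
    using t(1) by simp
  also have "e * norm h = (norm (g' h) - L * norm h) / 2"
    using h by (simp add: e_def)
  finally show False
    using gt by argo
qed

lemma second_difference_mean_value:
  fixes f :: "real^'n \<Rightarrow> real"
  assumes grad: "\<And>x. (f has_derivative (\<lambda>h. gradf x \<bullet> h)) (at x)"
    and hess: "\<And>x. (gradf has_derivative (\<lambda>h. H x *v h)) (at x)"
    and t: "0 < t"
  obtains p where "norm (p - x) \<le> t * (norm u + norm w)"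
    and "f (x + t *\<^sub>R u + t *\<^sub>R w) - f (x + t *\<^sub>R u) - f (x + t *\<^sub>R w) + f x =
      t\<^sup>2 * ((H p *v w) \<bullet> u)"
proof -
  define \<phi> where "\<phi> s = f (x + s *\<^sub>R u + t *\<^sub>R w) - f (x + s *\<^sub>R u)" for s
  have "(\<phi> has_derivative (\<lambda>h. gradf (x + s *\<^sub>R u + t *\<^sub>R w) \<bullet> (h *\<^sub>R u) -
      gradf (x + s *\<^sub>R u) \<bullet> (h *\<^sub>R u))) (at s within {0..t})" for s
    unfolding \<phi>_def
    by (intro has_derivative_diff has_derivative_compose[OF _ grad] derivative_eq_intros) auto
  from mvt_simple[OF t, of \<phi>, OF this] obtain \<xi> where \<xi>: "\<xi> \<in> {0<..<t}"
    and \<phi>: "\<phi> t - \<phi> 0 = t * (gradf (x + \<xi> *\<^sub>R u + t *\<^sub>R w) \<bullet> u - gradf (x + \<xi> *\<^sub>R u) \<bullet> u)"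
    by (auto simp: algebra_simps)
  define \<psi> where "\<psi> r = gradf (x + \<xi> *\<^sub>R u + r *\<^sub>R w) \<bullet> u" for r
  have "(\<psi> has_derivative (\<lambda>h. (H (x + \<xi> *\<^sub>R u + r *\<^sub>R w) *v (h *\<^sub>R w)) \<bullet> u)) (at r within {0..t})" for r
    unfolding \<psi>_def
    by (intro bounded_linear.has_derivative[OF bounded_linear_inner_left]
        has_derivative_compose[OF _ hess] derivative_eq_intros) auto
  from mvt_simple[OF t, of \<psi>, OF this] obtain \<eta> where \<eta>: "\<eta> \<in> {0<..<t}"
    and \<psi>: "\<psi> t - \<psi> 0 = t * ((H (x + \<xi> *\<^sub>R u + \<eta> *\<^sub>R w) *v w) \<bullet> u)"
    by (auto simp: matrix_vector_mult_scaleR)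
  show ?thesis
  proof
    have "norm ((x + \<xi> *\<^sub>R u + \<eta> *\<^sub>R w) - x) \<le> \<xi> * norm u + \<eta> * norm w"
      using \<xi> \<eta> norm_triangle_ineq[of "\<xi> *\<^sub>R u" "\<eta> *\<^sub>R w"] by (simp add: add.assoc)
    also have "\<dots> \<le> t * norm u + t * norm w"
      using \<xi> \<eta> by (intro add_mono mult_right_mono) simp_all
    finally show "norm ((x + \<xi> *\<^sub>R u + \<eta> *\<^sub>R w) - x) \<le> t * (norm u + norm w)"
      by (simp add: distrib_left)
    have "f (x + t *\<^sub>R u + t *\<^sub>R w) - f (x + t *\<^sub>R u) - f (x + t *\<^sub>R w) + f x = \<phi> t - \<phi> 0"
      by (simp add: \<phi>_def)
    also have "\<dots> = t * (\<psi> t - \<psi> 0)"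
      by (simp add: \<phi> \<psi>_def)
    finally show "f (x + t *\<^sub>R u + t *\<^sub>R w) - f (x + t *\<^sub>R u) - f (x + t *\<^sub>R w) + f x =
        t\<^sup>2 * ((H (x + \<xi> *\<^sub>R u + \<eta> *\<^sub>R w) *v w) \<bullet> u)"
      by (simp add: \<psi> power2_eq_square)
  qed
qed

lemma mixed_second_derivatives_near:
  fixes f :: "real^'n \<Rightarrow> real"
  assumes grad: "\<And>x. (f has_derivative (\<lambda>h. gradf x \<bullet> h)) (at x)"
    and hess: "\<And>x. (gradf has_derivative (\<lambda>h. H x *v h)) (at x)"
    and t: "0 < t"
  obtains p p' where "norm (p - x) \<le> t * (norm u + norm w)" and "norm (p' - x) \<le> t * (norm u + norm w)"
    and "(H p *v w) \<bullet> u = (H p' *v u) \<bullet> w"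
proof -
  obtain p where p: "norm (p - x) \<le> t * (norm u + norm w)"
    "f (x + t *\<^sub>R u + t *\<^sub>R w) - f (x + t *\<^sub>R u) - f (x + t *\<^sub>R w) + f x = t\<^sup>2 * ((H p *v w) \<bullet> u)"
    using second_difference_mean_value[OF grad hess t] by blast
  obtain p' where p': "norm (p' - x) \<le> t * (norm w + norm u)"
    "f (x + t *\<^sub>R w + t *\<^sub>R u) - f (x + t *\<^sub>R w) - f (x + t *\<^sub>R u) + f x = t\<^sup>2 * ((H p' *v u) \<bullet> w)"
    using second_difference_mean_value[OF grad hess t] by blast
  have "t\<^sup>2 * ((H p *v w) \<bullet> u) = t\<^sup>2 * ((H p' *v u) \<bullet> w)"
    using p(2) p'(2) by (simp add: algebra_simps)
  with t p(1) p'(1) show ?thesis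
    using that by (simp add: add.commute)
qed

lemma hessian_self_adjoint:
  fixes f :: "real^'n \<Rightarrow> real"
  assumes grad: "\<And>x. (f has_derivative (\<lambda>h. gradf x \<bullet> h)) (at x)"
    and hess: "\<And>x. (gradf has_derivative (\<lambda>h. H x *v h)) (at x)"
    and cont: "isCont H x"
  shows "(H x *v u) \<bullet> w = u \<bullet> (H x *v w)"
proof -
  define g1 g2 where "g1 p = (H p *v w) \<bullet> u" and "g2 p = (H p *v u) \<bullet> w" for p
  have "(H \<longlongrightarrow> H x) (at x)"
    using cont by (simp add: isCont_def)
  then have "isCont g1 x" "isCont g2 x"
    unfolding isCont_def g1_def g2_def inner_vec_def matrix_vector_mult_def
    by (intro tendsto_intros; assumption)+
  define t where "t n = inverse (real (Suc n))" for n
  have "\<exists>p p'. norm (p - x) \<le> t n * (norm u + norm w) \<and> norm (p' - x) \<le> t n * (norm u + norm w)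
      \<and> g1 p = g2 p'" for n
    using mixed_second_derivatives_near[OF grad hess, of "t n" x u w]
    unfolding g1_def g2_def t_def by (metis of_nat_0_less_iff positive_imp_inverse_positive zero_less_Suc)
  then obtain p p' where p: "\<And>n. norm (p n - x) \<le> t n * (norm u + norm w)"
    and p': "\<And>n. norm (p' n - x) \<le> t n * (norm u + norm w)" and eq: "\<And>n. g1 (p n) = g2 (p' n)"
    by metis
  have t0: "(\<lambda>n. t n * (norm u + norm w)) \<longlonglongrightarrow> 0"
    unfolding t_def by (intro tendsto_mult_left_zero LIMSEQ_inverse_real_of_nat)
  have "p \<longlonglongrightarrow> x" "p' \<longlonglongrightarrow> x"
    using Lim_null_comparison[OF always_eventually[OF allI[OF p]] t0]
      Lim_null_comparison[OF always_eventually[OF allI[OF p']] t0]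
    by (simp_all add: LIM_zero_iff)
  then have "(\<lambda>n. g1 (p n)) \<longlonglongrightarrow> g1 x" "(\<lambda>n. g2 (p' n)) \<longlonglongrightarrow> g2 x"
    using \<open>isCont g1 x\<close> \<open>isCont g2 x\<close> by (simp_all add: isCont_tendsto_compose)
  then have "g1 x = g2 x"
    unfolding eq by (rule LIMSEQ_unique)
  then show ?thesis
    by (simp add: g1_def g2_def inner_commute)
qed

section \<open>Block coordinate steps and their linearization\<close>

definition coord_proj :: "'n::finite set \<Rightarrow> real^'n^'n" where
  "coord_proj S = (\<chi> i j. if i = j \<and> i \<in> S then 1 else 0)"

lemma coord_proj_component: "(coord_proj S *v v) $ i = (if i \<in> S then v $ i else 0)"
proof -
  have "(coord_proj S *v v) $ i = (\<Sum>j\<in>UNIV. (if i = j \<and> i \<in> S then 1 else 0) * v $ j)"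
    by (simp add: coord_proj_def matrix_vector_mult_def)
  also have "\<dots> = (\<Sum>j\<in>UNIV. if j = i then (if i \<in> S then v $ i else 0) else 0)"
    by (intro sum.cong) auto
  finally show ?thesis by simp
qed

lemma norm_coord_proj_le: "norm (coord_proj S *v v) \<le> norm v"
  by (rule norm_le_componentwise_cart) (simp add: coord_proj_component)

lemma inner_coord_proj: "(coord_proj S *v v) \<bullet> v = (norm (coord_proj S *v v))\<^sup>2"
proof -
  have "(coord_proj S *v v) \<bullet> v = (coord_proj S *v v) \<bullet> (coord_proj S *v v)"
    unfolding inner_vec_def by (intro sum.cong) (auto simp: coord_proj_component)
  then show ?thesis by (simp add: power2_norm_eq_inner)
qed

lemma coord_proj_cover_eq_0:
  assumes "\<Union>(set Bs) = UNIV" and "\<And>S. S \<in> set Bs \<Longrightarrow> coord_proj S *v v = 0"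
  shows "v = 0"
proof -
  have "v $ i = 0" for i
  proof -
    have "i \<in> \<Union>(set Bs)"
      using assms(1) by simp
    then obtain S where "S \<in> set Bs" "i \<in> S"
      by blast
    then show ?thesis
      using assms(2)[of S] coord_proj_component[of S v i] by simp
  qed
  then show ?thesis by (simp add: Finite_Cartesian_Product.vec_eq_iff)
qed

lemma block_step_coord_proj: "block_step \<alpha> gradf S x = x + \<alpha> *\<^sub>R (coord_proj S *v gradf x)"
  by (simp add: block_step_def Finite_Cartesian_Product.vec_eq_iff coord_proj_component)

definition block_jacobian :: "real \<Rightarrow> real^'n::finite^'n \<Rightarrow> 'n set list \<Rightarrow> real^'n^'n" where
  "block_jacobian \<alpha> H Bs = foldr (\<lambda>S M. (Finite_Cartesian_Product.mat 1 + \<alpha> *\<^sub>R (coord_proj S ** H)) ** M) Bs (Finite_Cartesian_Product.mat 1)"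

lemma block_jacobian_Nil: "block_jacobian \<alpha> H [] *v h = h"
  by (simp add: block_jacobian_def)

lemma block_jacobian_Cons:
  "block_jacobian \<alpha> H (S # Bs) *v h =
    block_jacobian \<alpha> H Bs *v h + \<alpha> *\<^sub>R (coord_proj S *v (H *v (block_jacobian \<alpha> H Bs *v h)))"
proof -
  let ?y = "block_jacobian \<alpha> H Bs *v h"
  have "block_jacobian \<alpha> H (S # Bs) *v h =
      (Finite_Cartesian_Product.mat 1 + \<alpha> *\<^sub>R (coord_proj S ** H)) *v ?y"
    by (simp add: block_jacobian_def matrix_vector_mul_assoc)
  also have "\<dots> = ?y + (\<alpha> *\<^sub>R (coord_proj S ** H)) *v ?y"
    by (simp only: matrix_vector_mult_add_rdistrib matrix_vector_mul_lid)
  also have "(\<alpha> *\<^sub>R (coord_proj S ** H)) *v ?y = \<alpha> *\<^sub>R (coord_proj S *v (H *v ?y))"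
    by (simp only: scaleR_matrix_vector_assoc[symmetric] matrix_vector_mul_assoc[symmetric])
  finally show ?thesis .
qed

lemma matrix_inv_mult:
  assumes "invertible (A :: 'a::semiring_1^'n^'n)"
  shows "A ** matrix_inv A = Finite_Cartesian_Product.mat 1"
    and "matrix_inv A ** A = Finite_Cartesian_Product.mat 1"
  using someI_ex[OF assms[unfolded invertible_def]] unfolding matrix_inv_def by auto

locale block_linearization =
  fixes H :: "real^'n^'n" and L \<alpha> :: real
  assumes self_adjoint: "\<And>x y. (H *v x) \<bullet> y = x \<bullet> (H *v y)"
    and H_bound: "\<And>v. norm (H *v v) \<le> L * norm v"
    and alpha_pos: "0 < \<alpha>"
    and alpha_L: "\<alpha> * L < 1"
begin

lemma quad_form_block_step:
  "quad_form H y + \<alpha> * (norm (coord_proj S *v (H *v y)))\<^sup>2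
    \<le> quad_form H (y + \<alpha> *\<^sub>R (coord_proj S *v (H *v y)))"
proof -
  define d where "d = \<alpha> *\<^sub>R (coord_proj S *v (H *v y))"
  define n where "n = (norm (coord_proj S *v (H *v y)))\<^sup>2"
  have "y \<bullet> (H *v d) = (H *v d) \<bullet> y"
    by (rule inner_commute)
  also have "\<dots> = d \<bullet> (H *v y)"
    by (rule self_adjoint)
  finally have "y \<bullet> (H *v d) = d \<bullet> (H *v y)" .
  then have "quad_form H (y + d) = quad_form H y + 2 * (d \<bullet> (H *v y)) + d \<bullet> (H *v d)"
    by (simp add: quad_form_def matrix_vector_right_distrib inner_add_left inner_add_right)
  moreover have "d \<bullet> (H *v y) = \<alpha> * n"
    by (simp add: d_def n_def inner_coord_proj)
  moreover have "- (L * (\<alpha>\<^sup>2 * n)) \<le> d \<bullet> (H *v d)"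
  proof -
    have "\<bar>d \<bullet> (H *v d)\<bar> \<le> norm d * norm (H *v d)"
      by (rule Cauchy_Schwarz_ineq2)
    also have "\<dots> \<le> norm d * (L * norm d)"
      by (rule mult_left_mono[OF H_bound norm_ge_zero])
    also have "\<dots> = L * (\<alpha>\<^sup>2 * n)"
      using alpha_pos by (simp add: d_def n_def power2_eq_square)
    finally show ?thesis
      by (simp add: abs_le_iff)
  qed
  moreover have "L * (\<alpha>\<^sup>2 * n) \<le> \<alpha> * n"
  proof -
    have "(\<alpha> * L) * n \<le> 1 * n"
      using alpha_L by (intro mult_right_mono) (simp_all add: n_def)
    then have "\<alpha> * ((\<alpha> * L) * n) \<le> \<alpha> * n"
      using alpha_pos by (intro mult_left_mono) simp_all
    then show ?thesis
      by (simp add: power2_eq_square mult.assoc mult.left_commute)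
  qed
  ultimately have "quad_form H y + \<alpha> * n \<le> quad_form H (y + d)"
    by linarith
  then show ?thesis
    unfolding d_def n_def .
qed

lemma quad_form_block_jacobian:
  "quad_form H x \<le> quad_form H (block_jacobian \<alpha> H Bs *v x) \<and>
    (quad_form H (block_jacobian \<alpha> H Bs *v x) \<le> quad_form H x \<longrightarrow>
      block_jacobian \<alpha> H Bs *v x = x \<and> (\<forall>S \<in> set Bs. coord_proj S *v (H *v x) = 0))"
proof (induction Bs)
  case Nil
  show ?case by (simp add: block_jacobian_Nil)
next
  case (Cons S Bs)
  define y where "y = block_jacobian \<alpha> H Bs *v x"
  define n where "n = \<alpha> * (norm (coord_proj S *v (H *v y)))\<^sup>2"
  have eq: "block_jacobian \<alpha> H (S # Bs) *v x = y + \<alpha> *\<^sub>R (coord_proj S *v (H *v y))"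
    unfolding y_def by (rule block_jacobian_Cons)
  have step: "quad_form H y + n \<le> quad_form H (block_jacobian \<alpha> H (S # Bs) *v x)"
    unfolding eq n_def by (rule quad_form_block_step)
  have "0 \<le> n"
    using alpha_pos by (simp add: n_def)
  have IH1: "quad_form H x \<le> quad_form H y"
    using Cons.IH unfolding y_def by (rule conjunct1)
  have IH2: "quad_form H y \<le> quad_form H x \<Longrightarrow> y = x \<and> (\<forall>S \<in> set Bs. coord_proj S *v (H *v x) = 0)"
    using Cons.IH unfolding y_def by blast
  show ?case
  proof (intro conjI impI)
    show "quad_form H x \<le> quad_form H (block_jacobian \<alpha> H (S # Bs) *v x)"
      using IH1 step \<open>0 \<le> n\<close> by linarith
    assume "quad_form H (block_jacobian \<alpha> H (S # Bs) *v x) \<le> quad_form H x"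
    then have "n \<le> 0" "quad_form H y \<le> quad_form H x"
      using IH1 step \<open>0 \<le> n\<close> by linarith+
    then have P0: "coord_proj S *v (H *v y) = 0" and "y = x"
      and rest: "\<forall>S \<in> set Bs. coord_proj S *v (H *v x) = 0"
      using alpha_pos IH2 by (auto simp: n_def mult_le_0_iff)
    then show "block_jacobian \<alpha> H (S # Bs) *v x = x"
      "\<forall>S' \<in> set (S # Bs). coord_proj S' *v (H *v x) = 0"
      by (simp_all add: eq)
  qed
qed

lemma block_jacobian_kernel: "H *v k = 0 \<Longrightarrow> block_jacobian \<alpha> H Bs *v k = k"
  by (induction Bs) (simp_all add: block_jacobian_Nil block_jacobian_Cons)

lemma block_jacobian_eq_0: "block_jacobian \<alpha> H Bs *v h = 0 \<Longrightarrow> h = 0"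
proof (induction Bs arbitrary: h)
  case (Cons S Bs)
  define y where "y = block_jacobian \<alpha> H Bs *v h"
  have "y = - (\<alpha> *\<^sub>R (coord_proj S *v (H *v y)))"
    using Cons.prems unfolding block_jacobian_Cons y_def[symmetric] by (rule eq_neg_iff_add_eq_0[THEN iffD2])
  then have "norm y = norm (- (\<alpha> *\<^sub>R (coord_proj S *v (H *v y))))"
    by (rule arg_cong)
  also have "\<dots> = \<alpha> * norm (coord_proj S *v (H *v y))"
    using alpha_pos by simp
  also have "\<dots> \<le> \<alpha> * (L * norm y)"
    using alpha_pos norm_coord_proj_le[of S "H *v y"] H_bound[of y]
    by (intro mult_left_mono) simp_all
  finally have "(1 - \<alpha> * L) * norm y \<le> 0"
    by (simp add: algebra_simps)
  then have "y = 0"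
    using alpha_L by (simp add: mult_le_0_iff)
  then show ?case
    unfolding y_def by (rule Cons.IH)
qed (simp add: block_jacobian_Nil)

lemma invertible_block_jacobian: "invertible (block_jacobian \<alpha> H Bs)"
proof -
  have "inj ((*v) (block_jacobian \<alpha> H Bs))"
  proof (rule injI)
    fix a b
    assume "block_jacobian \<alpha> H Bs *v a = block_jacobian \<alpha> H Bs *v b"
    then have "block_jacobian \<alpha> H Bs *v (a - b) = 0"
      by (simp add: matrix_vector_mult_diff_distrib)
    then have "a - b = 0"
      by (rule block_jacobian_eq_0)
    then show "a = b"
      by simp
  qed
  then show ?thesis
    by (simp add: invertible_left_inverse matrix_left_invertible_injective)
qed

lemma quadratic_descent_inverse_block_jacobian:
  assumes cover: "\<Union>(set Bs) = UNIV"
  shows "quadratic_descent (matrix_inv (block_jacobian \<alpha> H Bs)) H"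
proof
  let ?M = "block_jacobian \<alpha> H Bs"
  let ?J = "matrix_inv (block_jacobian \<alpha> H Bs)"
  have MJ: "?M *v (?J *v x) = x" and JM: "?J *v (?M *v x) = x" for x
    using matrix_inv_mult[OF invertible_block_jacobian] by (simp_all add: matrix_vector_mul_assoc)
  show "(H *v x) \<bullet> y = x \<bullet> (H *v y)" for x y
    by (rule self_adjoint)
  show "quad_form H (?J *v x) \<le> quad_form H x" for x
    using quad_form_block_jacobian[of "?J *v x" Bs] by (simp add: MJ)
  show "H *v x = 0" if "quad_form H x \<le> quad_form H (?J *v x)" for x
  proof -
    have "quad_form H (?M *v (?J *v x)) \<le> quad_form H (?J *v x)"
      using that by (simp only: MJ)
    then have "?M *v (?J *v x) = ?J *v x" and "\<forall>S \<in> set Bs. coord_proj S *v (H *v (?J *v x)) = 0"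
      using quad_form_block_jacobian[of "?J *v x" Bs] by blast+
    then have "x = ?J *v x" and "H *v (?J *v x) = 0"
      using coord_proj_cover_eq_0[OF cover] by (simp only: MJ, blast)
    then show ?thesis
      by metis
  qed
  show "?J *v k = k" if "H *v k = 0" for k
    using JM[of k] block_jacobian_kernel[OF that] by simp
qed

end

lemma block_step_has_derivative:
  assumes "(gradf has_derivative (\<lambda>h. H *v h)) (at y)"
  shows "(block_step \<alpha> gradf S has_derivative (\<lambda>h. h + \<alpha> *\<^sub>R (coord_proj S *v (H *v h)))) (at y)"
proof -
  have "((\<lambda>x. coord_proj S *v gradf x) has_derivative (\<lambda>h. coord_proj S *v (H *v h))) (at y)"
    by (rule bounded_linear.has_derivative[OF matrix_vector_mul_bounded_linear assms])
  then show ?thesis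
    unfolding block_step_coord_proj[abs_def] by (intro derivative_eq_intros) auto
qed

lemma block_map_Cons: "block_map \<alpha> gradf (S # Bs) = block_step \<alpha> gradf S \<circ> block_map \<alpha> gradf Bs"
  by (simp add: block_map_def)

lemma block_map_fixed_point: "gradf x = 0 \<Longrightarrow> block_map \<alpha> gradf Bs x = x"
  by (induction Bs) (simp_all add: block_map_def block_step_coord_proj)

lemma block_map_has_derivative:
  assumes "(gradf has_derivative (\<lambda>h. H *v h)) (at x)" and "gradf x = 0"
  shows "(block_map \<alpha> gradf Bs has_derivative (\<lambda>h. block_jacobian \<alpha> H Bs *v h)) (at x)"
proof (induction Bs)
  case Nil
  show ?case by (simp add: block_map_def block_jacobian_Nil id_def)
next
  case (Cons S Bs)
  have "(block_step \<alpha> gradf S has_derivative (\<lambda>h. h + \<alpha> *\<^sub>R (coord_proj S *v (H *v h))))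
      (at (block_map \<alpha> gradf Bs x))"
    using block_step_has_derivative[OF assms(1)] by (simp add: block_map_fixed_point[where gradf=gradf, OF assms(2)])
  from diff_chain_at[OF Cons.IH this] show ?case
    by (simp add: block_map_Cons block_jacobian_Cons o_def)
qed

lemma continuous_on_block_map:
  assumes "continuous_on UNIV gradf"
  shows "continuous_on UNIV (block_map \<alpha> gradf Bs)"
proof (induction Bs)
  case Nil
  show ?case by (simp add: block_map_def)
next
  case (Cons S Bs)
  have "continuous_on UNIV (block_step \<alpha> gradf S)"
    unfolding block_step_coord_proj[abs_def]
    by (intro continuous_intros bounded_linear.continuous_on[OF matrix_vector_mul_bounded_linear assms])
  with Cons.IH show ?case
    unfolding block_map_Cons by (rule continuous_on_compose[OF _ continuous_on_subset]) simp
qed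

lemma inj_block_step:
  assumes lip: "\<And>x y. norm (gradf x - gradf y) \<le> L * norm (x - y)"
    and "0 \<le> \<alpha>" and "\<alpha> * L < 1"
  shows "inj (block_step \<alpha> gradf S)"
proof (rule injI)
  fix x y
  assume "block_step \<alpha> gradf S x = block_step \<alpha> gradf S y"
  then have "x - y = \<alpha> *\<^sub>R (coord_proj S *v (gradf y - gradf x))"
    by (simp add: block_step_coord_proj matrix_vector_mult_diff_distrib algebra_simps)
  then have "norm (x - y) = \<alpha> * norm (coord_proj S *v (gradf y - gradf x))"
    using \<open>0 \<le> \<alpha>\<close> by simp
  also have "\<dots> \<le> \<alpha> * (L * norm (x - y))"
    using \<open>0 \<le> \<alpha>\<close> norm_coord_proj_le[of S "gradf y - gradf x"] lip[of y x]
    by (intro mult_left_mono) (simp_all add: norm_minus_commute)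
  finally have "(1 - \<alpha> * L) * norm (x - y) \<le> 0"
    by (simp add: algebra_simps)
  with \<open>\<alpha> * L < 1\<close> show "x = y"
    by (simp add: mult_le_0_iff)
qed

lemma inj_block_map:
  assumes "\<And>x y. norm (gradf x - gradf y) \<le> L * norm (x - y)"
    and "0 \<le> \<alpha>" and "\<alpha> * L < 1"
  shows "inj (block_map \<alpha> gradf Bs)"
proof (induction Bs)
  case Nil
  show ?case by (simp add: block_map_def)
next
  case (Cons S Bs)
  show ?case
    unfolding block_map_Cons by (rule inj_compose[OF inj_block_step[OF assms] Cons.IH])
qed

lemma has_derivative_inv_at_fixed_point:
  fixes f :: "real^'n \<Rightarrow> real^'n"
  assumes "continuous_on UNIV f" and "inj f" and "f x = x"
    and "(f has_derivative (\<lambda>h. A *v h)) (at x)" and "invertible A"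
  shows "(inv f has_derivative (\<lambda>h. matrix_inv A *v h)) (at x)"
proof -
  have "(inv f has_derivative (\<lambda>h. matrix_inv A *v h)) (at (f x))"
  proof (rule has_derivative_inverse_strong[OF open_UNIV UNIV_I assms(1) _ assms(4)])
    show "inv f (f y) = y" for y
      using assms(2) by simp
    show "(\<lambda>h. A *v h) \<circ> (\<lambda>h. matrix_inv A *v h) = id"
      using matrix_inv_mult(1)[OF assms(5)] by (simp add: fun_eq_iff matrix_vector_mul_assoc)
  qed
  with assms(3) show ?thesis
    by simp
qed

theorem proposition9:
  fixes f :: "real^'n \<Rightarrow> real"
    and gradf :: "real^'n \<Rightarrow> real^'n"
    and H :: "real^'n \<Rightarrow> real^'n^'n"
    and L \<alpha> :: real
    and Bs :: "'n set list"
    and xs :: "real^'n"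
  assumes grad: "\<And>x. (f has_derivative (\<lambda>h. gradf x \<bullet> h)) (at x)"
    and hess: "\<And>x. (gradf has_derivative (\<lambda>h. H x *v h)) (at x)"
    and hess_cont: "continuous_on UNIV H"
    and Lpos: "L > 0"
    and lip: "\<And>x y. norm (gradf x - gradf y) \<le> L * norm (x - y)"
    and alpha: "0 < \<alpha>" "\<alpha> < 1 / L"
    and blocks: "block_partition Bs"
    and crit: "gradf xs = 0"
    and saddle: "lambda_min (H xs) < 0"
  shows "\<exists>J. (inv (block_map \<alpha> gradf Bs) has_derivative (\<lambda>h. J *v h)) (at xs)
             \<and> (\<exists>\<mu> \<in> complex_eigenvalues J. norm \<mu> > 1)"
proof -
  have self_adjoint: "\<And>u w. (H xs *v u) \<bullet> w = u \<bullet> (H xs *v w)"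
    using hessian_self_adjoint[OF grad hess] hess_cont by (simp add: continuous_on_eq_continuous_at)
  have "\<alpha> * L < 1"
    using alpha Lpos by (simp add: pos_less_divide_eq mult.commute)
  then interpret block_linearization "H xs" L \<alpha>
    using self_adjoint derivative_norm_le_Lipschitz[OF hess lip] alpha(1) by unfold_locales
  define J where "J = matrix_inv (block_jacobian \<alpha> (H xs) Bs)"
  have "\<Union>(set Bs) = UNIV"
    using blocks by (simp add: block_partition_def)
  then interpret quadratic_descent J "H xs"
    unfolding J_def by (rule quadratic_descent_inverse_block_jacobian)
  have "continuous_on UNIV gradf"
    using hess by (meson continuous_at_imp_continuous_on has_derivative_continuous)
  then have "(inv (block_map \<alpha> gradf Bs) has_derivative (\<lambda>h. J *v h)) (at xs)"
    unfolding J_def using lip alpha(1) \<open>\<alpha> * L < 1\<close>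
    by (intro has_derivative_inv_at_fixed_point continuous_on_block_map inj_block_map
        block_map_fixed_point block_map_has_derivative hess crit invertible_block_jacobian) auto
  moreover obtain v where "v \<noteq> 0" "H xs *v v = lambda_min (H xs) *\<^sub>R v"
    using lambda_min_eigenvector[OF self_adjoint] by blast
  then have "quad_form (H xs) v < 0"
    using saddle by (simp add: quad_form_def mult_neg_pos)
  then have "\<exists>\<mu> \<in> complex_eigenvalues J. 1 < norm \<mu>"
    by (rule eigenvalue_outside_unit_disc)
  ultimately show ?thesis
    by blast
qed

end
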